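(* There exist Boolean functions $f_n\in\mathbb{MM}_n$ (for $n\to\infty$) with real polynomial degree $\mathrm{pdeg}(f_n)=n-\Theta(\log n)$.
   Context: $\mathbb{MM}_n$ is the set of functions $f:\mathbb{F}_2^{n_1}\times\mathbb{F}_2^{n_2}\to\mathbb{F}_2$, $n_1+n_2=n$, of the form $f(\mathbf{x},\mathbf{y})=(\phi(\mathbf{x})\cdot\mathbf{y})\oplus g(\mathbf{x})$ with $\phi:\mathbb{F}_2^{n_1}\to\mathbb{F}_2^{n_2}$, $g:\mathbb{F}_2^{n_1}\to\mathbb{F}_2$, such that $\phi(\mathbf{1}_{n_1})=\mathbf{1}_{n_2}$, $g(\mathbf{1}_{n_1})=0$, and for each $1\le i\le n_1$, $\phi(\mathbf{1}_{n_1}^i)$ has odd Hamming weight and $g(\mathbf{1}_{n_1}^i)\equiv n_2\pmod2$ (here $\mathbf{1}_m$ is the all-ones vector and $\mathbf{1}_{n_1}^i$ is $\mathbf{1}_{n_1}$ with the $i$-th bit flipped). Every function in $\mathbb{MM}_n$ has sensitivity $n$. $\mathrm{pdeg}$ is the real polynomial degree. *)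

theory Defs
  imports Complex_Main "HOL-Library.Z2" "HOL-Library.Landau_Symbols"
    "Jordan_Normal_Form.Matrix"
begin

text \<open>
  The space \<open>F_2^n\<close> is \<^term>\<open>carrier_vec n :: bit vec set\<close>, and a Boolean function in \<open>n\<close> variables
  is a function on \<^typ>\<open>bit vec\<close>; only its values on \<^term>\<open>carrier_vec n\<close> matter.
  Coordinates are numbered from \<open>0\<close>.
\<close>

type_synonym boolfun = "bit vec \<Rightarrow> bit"

definition ones :: "nat \<Rightarrow> bit vec" where
  "ones m = vec m (\<lambda>_. 1)"

text \<open>Adding a unit vector over \<open>F_2\<close> flips the corresponding bit.\<close>

definition ones_flip :: "nat \<Rightarrow> nat \<Rightarrow> bit vec" where
  "ones_flip m i = ones m + unit_vec m i"

definition hamming_weight :: "bit vec \<Rightarrow> nat" where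
  "hamming_weight v = card {i. i < dim_vec v \<and> v $ i = 1}"

text \<open>
  A pair \<open>(x, y)\<close> in \<open>F_2^n1 \<times> F_2^n2\<close> is identified with the concatenation of \<open>x\<close> and \<open>y\<close>
  in \<open>F_2^(n1 + n2)\<close>.
\<close>

definition MM :: "nat \<Rightarrow> boolfun set" where
  "MM n = {f. \<exists>n1 n2 \<phi> g.
      n1 + n2 = n \<and>
      \<phi> \<in> carrier_vec n1 \<rightarrow> carrier_vec n2 \<and>
      (\<forall>x \<in> carrier_vec n1. \<forall>y \<in> carrier_vec n2. f (x @\<^sub>v y) = \<phi> x \<bullet> y + g x) \<and>
      \<phi> (ones n1) = ones n2 \<and>
      g (ones n1) = 0 \<and>
      (\<forall>i < n1. odd (hamming_weight (\<phi> (ones_flip n1 i))) \<and>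
                g (ones_flip n1 i) = of_nat n2)}"

text \<open>
  A real multilinear polynomial in \<open>n\<close> variables is given by its coefficients
  \<open>c S\<close>, where \<open>S \<subseteq> {..<n}\<close> stands for the monomial \<open>\<Prod>i\<in>S. X_i\<close>. Coefficients of
  all other index sets are \<open>0\<close>.
\<close>

definition multilinear_eval :: "nat \<Rightarrow> (nat set \<Rightarrow> real) \<Rightarrow> (nat \<Rightarrow> real) \<Rightarrow> real" where
  "multilinear_eval n c x = (\<Sum>S \<in> Pow {..<n}. c S * (\<Prod>i\<in>S. x i))"

definition represents :: "nat \<Rightarrow> (nat set \<Rightarrow> real) \<Rightarrow> boolfun \<Rightarrow> bool" where
  "represents n c f \<longleftrightarrow>
     (\<forall>S. c S \<noteq> 0 \<longrightarrow> S \<subseteq> {..<n}) \<and>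
     (\<forall>x \<in> carrier_vec n. of_bit (f x) = multilinear_eval n c (\<lambda>i. of_bit (x $ i)))"

lemma multilinear_eval_indicator:
  assumes "T \<subseteq> {..<n}"
  shows "multilinear_eval n c (\<lambda>i. of_bool (i \<in> T)) = sum c (Pow T)"
proof -
  have p: "(\<Prod>i\<in>S. of_bool (i \<in> T) :: real) = of_bool (S \<subseteq> T)" if "S \<subseteq> {..<n}" for S
    using finite_subset[OF that] by (cases "S \<subseteq> T") (auto intro!: prod.neutral)
  have "multilinear_eval n c (\<lambda>i. of_bool (i \<in> T)) = (\<Sum>S \<in> Pow {..<n}. c S * of_bool (S \<subseteq> T))"
    unfolding multilinear_eval_def by (intro sum.cong) (auto simp: p)
  also have "\<dots> = (\<Sum>S \<in> Pow T. c S)"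
    using assms by (intro sum.mono_neutral_cong_right) auto
  finally show ?thesis .
qed

lemma represents_iff:
  "represents n c f \<longleftrightarrow>
     (\<forall>S. c S \<noteq> 0 \<longrightarrow> S \<subseteq> {..<n}) \<and>
     (\<forall>T \<subseteq> {..<n}. of_bit (f (vec n (\<lambda>i. of_bool (i \<in> T)))) = sum c (Pow T))"
proof -
  have ev: "multilinear_eval n c (\<lambda>i. of_bit (vec n (\<lambda>i. of_bool (i \<in> T)) $ i)) = sum c (Pow T)"
    if T: "T \<subseteq> {..<n}" for T
  proof -
    have "multilinear_eval n c (\<lambda>i. of_bit (vec n (\<lambda>i. of_bool (i \<in> T)) $ i))
        = multilinear_eval n c (\<lambda>i. of_bool (i \<in> T))"
      unfolding multilinear_eval_def
      by (intro sum.cong refl arg_cong2[of _ _ _ _ "(*)"] prod.cong) auto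
    then show ?thesis using multilinear_eval_indicator[OF T] by simp
  qed
  have ex: "\<exists>T \<subseteq> {..<n}. x = vec n (\<lambda>i. of_bool (i \<in> T))" if "x \<in> carrier_vec n" for x :: "bit vec"
    using that by (intro exI[of _ "{i. i < n \<and> x $ i = 1}"]) (auto intro!: eq_vecI)
  have "(\<forall>x \<in> carrier_vec n. of_bit (f x) = multilinear_eval n c (\<lambda>i. of_bit (x $ i))) \<longleftrightarrow>
        (\<forall>T \<subseteq> {..<n}. of_bit (f (vec n (\<lambda>i. of_bool (i \<in> T)))) = sum c (Pow T))"
    (is "?L \<longleftrightarrow> ?R")
  proof
    assume L: ?L
    show ?R
    proof (intro allI impI)
      fix T assume T: "T \<subseteq> {..<n}"
      show "of_bit (f (vec n (\<lambda>i. of_bool (i \<in> T)))) = sum c (Pow T)"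
        using bspec[OF L, of "vec n (\<lambda>i. of_bool (i \<in> T))"] ev[OF T] by (simp only: vec_carrier)
    qed
  next
    assume R: ?R
    show ?L
    proof
      fix x :: "bit vec" assume "x \<in> carrier_vec n"
      then obtain T where T: "T \<subseteq> {..<n}" and x: "x = vec n (\<lambda>i. of_bool (i \<in> T))"
        using ex by blast
      show "of_bit (f x) = multilinear_eval n c (\<lambda>i. of_bit (x $ i))"
        unfolding x ev[OF T] using R T by blast
    qed
  qed
  then show ?thesis unfolding represents_def by blast
qed

lemma represents_ex1: "\<exists>!c. represents n c f"
proof (rule ex_ex1I)
  define F :: "nat set \<Rightarrow> real" where "F = (\<lambda>T. of_bit (f (vec n (\<lambda>i. of_bool (i \<in> T)))))"
  define G where "G = (\<lambda>S. \<Sum>T\<in>Pow S. (-1) ^ card T * F T)"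
  define c where "c = (\<lambda>S. if S \<subseteq> {..<n} then (-1) ^ card S * G S else 0)"
  have "F T = sum c (Pow T)" if T: "T \<subseteq> {..<n}" for T
  proof -
    have "finite T" using T finite_subset by blast
    then have "F T = (\<Sum>S\<in>Pow T. (-1) ^ card S * G S)"
      by (rule inclusion_exclusion_symmetric[of G F, rotated]) (simp only: G_def)
    also have "\<dots> = sum c (Pow T)"
      using T by (intro sum.cong) (auto simp: c_def)
    finally show ?thesis .
  qed
  then show "\<exists>c. represents n c f"
    unfolding represents_iff by (intro exI[of _ c]) (auto simp: F_def c_def)
next
  fix c d assume c: "represents n c f" and d: "represents n d f"
  show "c = d"
  proof
    fix S
    show "c S = d S"
    proof (cases "S \<subseteq> {..<n}")
      case False
      then show ?thesis using c d unfolding represents_iff by metis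
    next
      case True
      then have "finite S" using finite_subset by blast
      from this True show ?thesis
      proof (induction S rule: finite_psubset_induct)
        case (psubset S)
        have split: "sum h (Pow S) = h S + sum h (Pow S - {S})" for h :: "nat set \<Rightarrow> real"
          using psubset.hyps by (intro sum.remove) auto
        have "sum c (Pow S) = sum d (Pow S)"
          using c d psubset.prems unfolding represents_iff by metis
        moreover have "sum c (Pow S - {S}) = sum d (Pow S - {S})"
          using psubset.IH psubset.prems by (intro sum.cong) auto
        ultimately show ?case by (simp add: split)
      qed
    qed
  qed
qed

text \<open>The real polynomial degree; the zero polynomial gets degree \<open>0\<close>.\<close>

definition real_poly :: "nat \<Rightarrow> boolfun \<Rightarrow> nat set \<Rightarrow> real" where
  "real_poly n f = (THE c. represents n c f)"

definition pdeg :: "nat \<Rightarrow> boolfun \<Rightarrow> nat" where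
  "pdeg n f = Max (insert 0 {card S | S. real_poly n f S \<noteq> 0})"

end

theory Submission
  imports Defs "HOL-Real_Asymp.Real_Asymp"
begin

text \<open>
  Take \<open>n2 = 1\<close>, \<open>\<phi>\<close> constantly \<open>1\<close>, and let \<open>g\<close> be the sum of \<open>t\<close> not-all-equal functions on
  disjoint triples and of the complements of the remaining variables. Degrees of sign functions
  \<open>1 - 2f\<close> add up over disjoint sets of variables; a triple contributes degree 2 instead of 3,
  although not-all-equal has full sensitivity at the all-ones point, and every other variable
  contributes 1. So the degree is exactly \<open>n - t\<close>, and \<open>t = \<lfloor>ln n\<rfloor>\<close> gives the claim.
\<close>

section \<open>Exact degree of set functions, and its additivity over disjoint variables\<close>

text \<open>A point of the cube is the set \<open>T\<close> of its 1-coordinates, so evaluating a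
  multilinear polynomial means summing coefficients over \<open>Pow T\<close>. The nonzero
  coefficient demanded at level \<open>d\<close> excludes the zero polynomial, for which degrees
  would not add up under products.\<close>

definition has_degree :: "'a set \<Rightarrow> ('a set \<Rightarrow> real) \<Rightarrow> nat \<Rightarrow> bool" where
  "has_degree A P d \<longleftrightarrow> (\<exists>c.
     (\<forall>S. c S \<noteq> 0 \<longrightarrow> S \<subseteq> A \<and> card S \<le> d) \<and>
     (\<exists>S. c S \<noteq> 0 \<and> card S = d) \<and>
     (\<forall>T \<subseteq> A. P T = sum c (Pow T)))"

lemma has_degreeE:
  assumes "has_degree A P d"
  obtains c U where "\<forall>S. c S \<noteq> 0 \<longrightarrow> S \<subseteq> A \<and> card S \<le> d"
    and "c U \<noteq> 0" and "card U = d" and "\<forall>T \<subseteq> A. P T = sum c (Pow T)"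
  using assms unfolding has_degree_def by auto

lemma has_degree_cong:
  assumes "has_degree A P d" and "\<And>T. T \<subseteq> A \<Longrightarrow> P T = Q T"
  shows "has_degree A Q d"
  using assms unfolding has_degree_def by auto

text \<open>Only the constant coefficient is shifted; \<open>d > 0\<close> keeps the top coefficient
  away from it. This allows a change between the values 0, 1 and the signs 1, -1.\<close>

lemma has_degree_affine:
  assumes P: "has_degree A P d" and A: "finite A" and b: "b \<noteq> 0" and d: "d > 0"
  shows "has_degree A (\<lambda>T. a + b * P T) d"
proof -
  obtain c U where supp: "\<forall>S. c S \<noteq> 0 \<longrightarrow> S \<subseteq> A \<and> card S \<le> d"
    and top: "c U \<noteq> 0" "card U = d" and val: "\<forall>T \<subseteq> A. P T = sum c (Pow T)"
    by (rule has_degreeE[OF P]) (rule that)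
  define c' where "c' = (\<lambda>S. (if S = {} then a else 0) + b * c S)"
  have "a + b * P T = sum c' (Pow T)" if T: "T \<subseteq> A" for T
  proof -
    have "finite (Pow T)" using T A finite_subset by auto
    then show ?thesis
      by (simp add: c'_def val T sum.distrib sum_distrib_left)
  qed
  moreover have "S \<subseteq> A \<and> card S \<le> d" if "c' S \<noteq> 0" for S
    using that supp by (cases "S = {}") (auto simp: c'_def)
  moreover have "c' U \<noteq> 0 \<and> card U = d"
    using top b d by (auto simp: c'_def)
  ultimately show ?thesis unfolding has_degree_def by blast
qed

lemma sum_Pow_Un_disjoint:
  fixes h k :: "'a set \<Rightarrow> 'b::comm_semiring_0"
  assumes AB: "A \<inter> B = {}" and T: "T \<subseteq> A \<union> B"
  shows "(\<Sum>S\<in>Pow T. h (S \<inter> A) * k (S \<inter> B)) = sum h (Pow (T \<inter> A)) * sum k (Pow (T \<inter> B))"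
proof -
  have "(\<Sum>S\<in>Pow T. h (S \<inter> A) * k (S \<inter> B)) =
        (\<Sum>(U, V)\<in>Pow (T \<inter> A) \<times> Pow (T \<inter> B). h U * k V)"
    by (rule sum.reindex_bij_witness[where i = "\<lambda>(U, V). U \<union> V" and j = "\<lambda>S. (S \<inter> A, S \<inter> B)"])
       (use AB T in auto)
  also have "\<dots> = sum h (Pow (T \<inter> A)) * sum k (Pow (T \<inter> B))"
    by (simp add: sum_product sum.cartesian_product)
  finally show ?thesis .
qed

text \<open>Over disjoint variables a monomial of the product splits in only one way, into its
  traces on \<open>A\<close> and \<open>B\<close>. Hence nothing cancels and the product of two top
  coefficients survives.\<close>

lemma has_degree_mult:
  assumes P: "has_degree A P d" and Q: "has_degree B Q e"
    and A: "finite A" and B: "finite B" and AB: "A \<inter> B = {}"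
  shows "has_degree (A \<union> B) (\<lambda>T. P (T \<inter> A) * Q (T \<inter> B)) (d + e)"
proof -
  obtain h U where h: "\<forall>S. h S \<noteq> 0 \<longrightarrow> S \<subseteq> A \<and> card S \<le> d"
    and U: "h U \<noteq> 0" "card U = d" and hP: "\<forall>T \<subseteq> A. P T = sum h (Pow T)"
    by (rule has_degreeE[OF P]) (rule that)
  obtain k V where k: "\<forall>S. k S \<noteq> 0 \<longrightarrow> S \<subseteq> B \<and> card S \<le> e"
    and V: "k V \<noteq> 0" "card V = e" and kQ: "\<forall>T \<subseteq> B. Q T = sum k (Pow T)"
    by (rule has_degreeE[OF Q]) (rule that)
  define c where "c = (\<lambda>S. if S \<subseteq> A \<union> B then h (S \<inter> A) * k (S \<inter> B) else 0)"
  have "S \<subseteq> A \<union> B \<and> card S \<le> d + e" if "c S \<noteq> 0" for S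
  proof -
    have S: "S \<subseteq> A \<union> B" "h (S \<inter> A) \<noteq> 0" "k (S \<inter> B) \<noteq> 0"
      using that by (auto simp: c_def split: if_splits)
    have "S = S \<inter> A \<union> S \<inter> B" using S(1) by auto
    then have "card S \<le> card (S \<inter> A) + card (S \<inter> B)" by (metis card_Un_le)
    then show ?thesis using h[rule_format, OF S(2)] k[rule_format, OF S(3)] S(1) by linarith
  qed
  moreover have "c (U \<union> V) \<noteq> 0 \<and> card (U \<union> V) = d + e"
  proof -
    have UV: "U \<subseteq> A" "V \<subseteq> B" using h U k V by blast+
    then have "(U \<union> V) \<inter> A = U" "(U \<union> V) \<inter> B = V" "U \<union> V \<subseteq> A \<union> B" "U \<inter> V = {}"
      using AB by auto
    moreover have "finite U" "finite V" using UV A B finite_subset by auto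
    ultimately show ?thesis using U V by (simp add: c_def card_Un_disjoint)
  qed
  moreover have "P (T \<inter> A) * Q (T \<inter> B) = sum c (Pow T)" if T: "T \<subseteq> A \<union> B" for T
  proof -
    have "sum c (Pow T) = (\<Sum>S\<in>Pow T. h (S \<inter> A) * k (S \<inter> B))"
      using T by (intro sum.cong) (auto simp: c_def)
    then show ?thesis by (simp add: sum_Pow_Un_disjoint[OF AB T] hP kQ)
  qed
  ultimately show ?thesis unfolding has_degree_def by blast
qed

lemma has_degree_prod:
  assumes "finite I"
    and "\<And>i. i \<in> I \<Longrightarrow> has_degree (A i) (P i) (d i)"
    and "\<And>i. i \<in> I \<Longrightarrow> finite (A i)"
    and "\<And>i j. i \<in> I \<Longrightarrow> j \<in> I \<Longrightarrow> i \<noteq> j \<Longrightarrow> A i \<inter> A j = {}"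
  shows "has_degree (\<Union>i\<in>I. A i) (\<lambda>T. \<Prod>i\<in>I. P i (T \<inter> A i)) (\<Sum>i\<in>I. d i)"
  using assms
proof (induction I rule: finite_induct)
  case empty
  show ?case unfolding has_degree_def
    by (intro exI[of _ "\<lambda>S. if S = {} then 1 else 0"]) auto
next
  case (insert i I)
  have "has_degree (A i \<union> (\<Union>j\<in>I. A j))
      (\<lambda>T. P i (T \<inter> A i) * (\<Prod>j\<in>I. P j (T \<inter> (\<Union>j\<in>I. A j) \<inter> A j))) (d i + (\<Sum>j\<in>I. d j))"
  proof (rule has_degree_mult)
    show "has_degree (\<Union>j\<in>I. A j) (\<lambda>T. \<Prod>j\<in>I. P j (T \<inter> A j)) (\<Sum>j\<in>I. d j)"
      using insert by blast
    show "A i \<inter> (\<Union>j\<in>I. A j) = {}"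
      using insert.prems(3)[of i] insert.hyps(2) by blast
  qed (use insert in auto)
  moreover have "T \<inter> (\<Union>j\<in>I. A j) \<inter> A j = T \<inter> A j" if "j \<in> I" for T j
    using that by auto
  ultimately show ?case using insert.hyps by (simp cong: prod.cong)
qed

text \<open>By uniqueness of the representation, any coefficients witnessing
  \<open>has_degree\<close> are those of \<open>real_poly\<close>.\<close>

lemma pdeg_eqI:
  assumes "has_degree {..<n} (\<lambda>T. of_bit (f (vec n (\<lambda>i. of_bool (i \<in> T))))) d"
  shows "pdeg n f = d"
proof -
  obtain c :: "nat set \<Rightarrow> real" and U where supp: "\<forall>S. c S \<noteq> 0 \<longrightarrow> S \<subseteq> {..<n} \<and> card S \<le> d"
    and top: "c U \<noteq> 0" "card U = d"
    and val: "\<forall>T \<subseteq> {..<n}. of_bit (f (vec n (\<lambda>i. of_bool (i \<in> T)))) = sum c (Pow T)"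
    by (rule has_degreeE[OF assms]) (rule that)
  have "represents n c f" unfolding represents_iff using supp val by blast
  then have "real_poly n f = c"
    unfolding real_poly_def by (rule the1_equality[OF represents_ex1])
  moreover have "finite {card S |S. c S \<noteq> 0}"
    by (rule finite_subset[of _ "{..d}"]) (use supp in auto)
  ultimately show ?thesis
    unfolding pdeg_def using supp top by (intro Max_eqI) auto
qed

section \<open>Sign functions of the building blocks\<close>

text \<open>The character (-1)^b of F_2: it turns sums of bits into products, to which
  \<open>has_degree_prod\<close> applies.\<close>

definition bit_sign :: "bit \<Rightarrow> real" where
  "bit_sign b = 1 - 2 * of_bit b"

lemma bit_sign_0 [simp]: "bit_sign 0 = 1" and bit_sign_1 [simp]: "bit_sign 1 = -1"
  by (simp_all add: bit_sign_def)

lemma bit_sign_add: "bit_sign (a + b) = bit_sign a * bit_sign b"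
  by (cases a; cases b) (simp_all add: bit_sign_def)

lemma bit_sign_sum: "bit_sign (sum h I) = (\<Prod>i\<in>I. bit_sign (h i))"
  by (induction I rule: infinite_finite_induct) (simp_all add: bit_sign_add del: add_bit_eq_xor)

lemma has_degree_parity: "has_degree {i} (\<lambda>T. bit_sign (of_bool (i \<in> T) + 1)) 1"
  unfolding has_degree_def
  \<comment> \<open>The sign of a complemented variable X is 2X - 1.\<close>
  by (intro exI[of _ "\<lambda>S. if S = {} then -1 else if S = {i} then 2 else 0"])
     (auto simp: subset_singleton_iff Pow_insert)

lemma sum_Pow_insert:
  assumes "finite A" "a \<notin> A"
  shows "sum h (Pow (insert a A)) = sum h (Pow A) + (\<Sum>S\<in>Pow A. h (insert a S))"
proof -
  have "inj_on (insert a) (Pow A)" using assms(2) by (auto simp: inj_on_def)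
  moreover have "Pow A \<inter> insert a ` Pow A = {}" using assms(2) by auto
  ultimately show ?thesis
    using assms(1) by (simp add: Pow_insert sum.union_disjoint sum.reindex)
qed

definition nae :: "bit \<Rightarrow> bit \<Rightarrow> bit \<Rightarrow> bit" where
  "nae a b c = of_bool (\<not> (a = b \<and> b = c))"

text \<open>The coefficients come from \<open>1 - 2(X + Y + Z - XY - YZ - ZX)\<close>.\<close>

lemma has_degree_nae:
  assumes "i \<noteq> j" "j \<noteq> k" "i \<noteq> k"
  shows "has_degree {i, j, k}
    (\<lambda>T. bit_sign (nae (of_bool (i \<in> T)) (of_bool (j \<in> T)) (of_bool (k \<in> T)))) 2"
proof -
  define c :: "'a set \<Rightarrow> real" where
    "c = (\<lambda>S. if S \<subseteq> {i, j, k} then if card S = 0 then 1 else if card S = 1 then -2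
              else if card S = 2 then 2 else 0 else 0)"
  have "bit_sign (nae (of_bool (i \<in> T)) (of_bool (j \<in> T)) (of_bool (k \<in> T))) = sum c (Pow T)"
    if "T \<subseteq> {i, j, k}" for T
  proof -
    have "T \<in> Pow {i, j, k}" using that by blast
    then consider "T = {}" | "T = {i}" | "T = {j}" | "T = {k}" | "T = {i, j}" | "T = {i, k}"
      | "T = {j, k}" | "T = {i, j, k}"
      by (auto simp: Pow_insert)
    \<comment> \<open>No cubic term is needed: on the full triple the coefficients sum to 1 - 6 + 6
      = 1, the sign of an all-equal input.\<close>
    then show ?thesis
      using assms by cases (simp_all add: nae_def sum_Pow_insert c_def assms[symmetric] card_insert_if)
  qed
  moreover have "S \<subseteq> {i, j, k} \<and> card S \<le> 2" if "c S \<noteq> 0" for S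
    using that by (auto simp: c_def split: if_splits)
  moreover have "c {i, j} \<noteq> 0 \<and> card {i, j} = 2"
    using assms by (simp add: c_def)
  ultimately show ?thesis unfolding has_degree_def by blast
qed

section \<open>The function and its degree\<close>

text \<open>The number of variables \<open>m\<close> is a parameter because the formula serves
  twice: for all variables, where the degree is computed, and without the last one, where it is
  \<open>g\<close>.\<close>

definition nae_parity :: "nat \<Rightarrow> nat \<Rightarrow> boolfun" where
  "nae_parity t m x = (\<Sum>j<t. nae (x $ (3 * j)) (x $ (3 * j + 1)) (x $ (3 * j + 2)))
                      + (\<Sum>i\<in>{3 * t..<m}. x $ i + 1)"

lemma pdeg_nae_parity:
  assumes tn: "3 * t < n"
  shows "pdeg n (\<lambda>x. nae_parity t n x + 1) = n - t"
proof (rule pdeg_eqI)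
  let ?x = "\<lambda>T. vec n (\<lambda>i. of_bool (i \<in> T)) :: bit vec"
  let ?B = "\<lambda>j. {3 * j, 3 * j + 1, 3 * j + 2 :: nat}"
  let ?p = "\<lambda>j (T :: nat set). bit_sign (nae (of_bool (3 * j \<in> T)) (of_bool (3 * j + 1 \<in> T))
                              (of_bool (3 * j + 2 \<in> T)))"
  let ?q = "\<lambda>(i :: nat) T. bit_sign (of_bool (i \<in> T) + 1)"
  have U: "(\<Union>j<t. ?B j) = {..<3 * t}"
  proof -
    have "i \<in> ?B (i div 3)" for i :: nat by simp presburger
    moreover have "i div 3 < t" if "i < 3 * t" for i using that by simp
    ultimately show ?thesis by fastforce
  qed
  have p: "has_degree (\<Union>j<t. ?B j) (\<lambda>T. \<Prod>j<t. ?p j (T \<inter> ?B j)) (\<Sum>j<t. 2)"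
  proof (rule has_degree_prod)
    show "has_degree (?B j) (?p j) 2" for j by (rule has_degree_nae) simp_all
    show "?B i \<inter> ?B j = {}" if "i \<noteq> j" for i j using that by auto
  qed auto
  have q: "has_degree (\<Union>i\<in>{3 * t..<n}. {i}) (\<lambda>T. \<Prod>i\<in>{3 * t..<n}. ?q i (T \<inter> {i}))
             (\<Sum>i\<in>{3 * t..<n}. 1)"
    by (rule has_degree_prod, simp, rule has_degree_parity) auto
  have "has_degree ({..<3 * t} \<union> {3 * t..<n})
      (\<lambda>T. (\<Prod>j<t. ?p j (T \<inter> {..<3 * t} \<inter> ?B j)) *
           (\<Prod>i\<in>{3 * t..<n}. ?q i (T \<inter> {3 * t..<n} \<inter> {i}))) (2 * t + (n - 3 * t))"
    using has_degree_mult[OF p[unfolded U] q] by (simp add: mult.commute ivl_disj_int)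
  moreover have "{..<3 * t} \<union> {3 * t..<n} = {..<n}" "2 * t + (n - 3 * t) = n - t"
    using tn by auto
  ultimately have "has_degree {..<n}
      (\<lambda>T. (\<Prod>j<t. ?p j (T \<inter> {..<3 * t} \<inter> ?B j)) *
           (\<Prod>i\<in>{3 * t..<n}. ?q i (T \<inter> {3 * t..<n} \<inter> {i}))) (n - t)"
    by simp
  then have "has_degree {..<n} (\<lambda>T. bit_sign (nae_parity t n (?x T))) (n - t)"
    by (rule has_degree_cong)
       (use tn in \<open>auto simp: nae_parity_def bit_sign_add bit_sign_sum
          simp del: add_bit_eq_xor intro!: arg_cong2[of _ _ _ _ "(*)"] prod.cong\<close>)
  then have "has_degree {..<n} (\<lambda>T. 1 / 2 + 1 / 2 * bit_sign (nae_parity t n (?x T))) (n - t)"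
    by (rule has_degree_affine) (use tn in auto)
  \<comment> \<open>Back from signs to 0/1 values; the positive coefficient 1/2 accounts for the
    added 1.\<close>
  moreover have "1 / 2 + 1 / 2 * bit_sign b = of_bit (b + 1)" for b
    by (cases b) simp_all
  ultimately show "has_degree {..<n} (\<lambda>T. of_bit (nae_parity t n (?x T) + 1)) (n - t)"
    by simp
qed

section \<open>Membership in \<open>MM\<close>\<close>

lemma nae_parity_ones:
  assumes "3 * t \<le> m"
  shows "nae_parity t m (ones m) = 0"
  using assms by (simp add: nae_parity_def ones_def nae_def)

text \<open>The flip changes exactly one summand from 0 to 1: the triple \<open>i div 3\<close> if
  \<open>i < 3 * t\<close>, otherwise the complement of bit \<open>i\<close>. As
  \<open>n2 = 1\<close>, this is the parity required of \<open>g\<close>.\<close>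

lemma nae_parity_ones_flip:
  assumes tm: "3 * t \<le> m" and i: "i < m"
  shows "nae_parity t m (ones_flip m i) = 1"
proof -
  have x: "ones_flip m i $ l = of_bool (l \<noteq> i)" if "l < m" for l
    using that i by (simp add: ones_flip_def ones_def)
  have "(\<Sum>j<t. nae (ones_flip m i $ (3 * j)) (ones_flip m i $ (3 * j + 1))
          (ones_flip m i $ (3 * j + 2))) = (\<Sum>j<t. if j = i div 3 then 1 else 0)"
  proof (intro sum.cong refl)
    fix j assume "j \<in> {..<t}"
    then have "3 * j + 2 < m" using tm by simp
    then show "nae (ones_flip m i $ (3 * j)) (ones_flip m i $ (3 * j + 1))
        (ones_flip m i $ (3 * j + 2)) = (if j = i div 3 then 1 else 0)"
      by (simp add: x nae_def) presburger
  qed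
  also have "\<dots> = of_bool (i < 3 * t)" by auto
  finally have *: "(\<Sum>j<t. nae (ones_flip m i $ (3 * j)) (ones_flip m i $ (3 * j + 1))
          (ones_flip m i $ (3 * j + 2))) = of_bool (i < 3 * t)" .
  have **: "(\<Sum>l\<in>{3 * t..<m}. ones_flip m i $ l + 1) = (\<Sum>l\<in>{3 * t..<m}. if l = i then 1 else 0)"
    by (intro sum.cong) (auto simp: x)
  have "(\<Sum>l\<in>{3 * t..<m}. if l = i then 1 else 0 :: bit) = of_bool (3 * t \<le> i)" using i by auto
  then show ?thesis unfolding nae_parity_def * ** by auto
qed

text \<open>The last variable plays the role of \<open>y\<close>. It lies outside the triples, and
  the 1 in its complement cancels the outer \<open>+ 1\<close>, leaving \<open>y\<close> plus
  \<open>g\<close>.\<close>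

lemma nae_parity_in_MM:
  assumes tm: "3 * t \<le> m"
  shows "(\<lambda>x. nae_parity t (Suc m) x + 1) \<in> MM (Suc m)"
proof -
  have "nae_parity t (Suc m) (x @\<^sub>v y) + 1 = ones 1 \<bullet> y + nae_parity t m x"
    if x: "x \<in> carrier_vec m" and y: "y \<in> carrier_vec 1" for x y
  proof -
    have "nae_parity t (Suc m) (x @\<^sub>v y)
        = (\<Sum>j<t. nae (x $ (3 * j)) (x $ (3 * j + 1)) (x $ (3 * j + 2)))
          + ((\<Sum>i\<in>{3 * t..<m}. x $ i + 1) + (y $ 0 + 1))"
      unfolding nae_parity_def using tm x y
      by (intro arg_cong2[of _ _ _ _ "(+)"] sum.cong)
         (auto simp: index_append_vec intro!: sum.cong)
    moreover have "ones 1 \<bullet> y = y $ 0"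
      using y by (cases "y $ 0 = 1") (auto simp: scalar_prod_def ones_def)
    moreover have "a + (b + (c + 1)) + 1 = c + (a + b)" for a b c :: bit
      by (cases a; cases b; cases c) simp_all
    ultimately show ?thesis by (simp only: nae_parity_def)
  qed
  moreover have "hamming_weight (ones 1) = 1"
    by (auto simp: hamming_weight_def ones_def card_1_singleton_iff intro!: exI[of _ 0])
  ultimately show ?thesis
    unfolding MM_def using tm nae_parity_ones[OF tm] nae_parity_ones_flip[OF tm]
    by (intro CollectI exI[of _ m] exI[of _ 1] exI[of _ "\<lambda>_. ones 1"] exI[of _ "nae_parity t m"])
       (auto simp: ones_def)
qed

theorem mainTheorem13:
  shows "\<exists>f :: nat \<Rightarrow> boolfun.
           (\<forall>\<^sub>F n in sequentially. f n \<in> MM n) \<and>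
           (\<lambda>n. real n - real (pdeg n (f n))) \<in> \<Theta>(\<lambda>n. ln (real n))"
proof -
  define t where "t = (\<lambda>n. nat \<lfloor>ln (real n)\<rfloor>)"
  define f where "f = (\<lambda>n x. nae_parity (t n) n x + 1)"
  \<comment> \<open>The extra 1 makes \<open>3 * t n < n\<close> strict, so that a variable is left
    over for \<open>y\<close>; nonnegativity makes \<open>nat\<close> harmless.\<close>
  have "\<forall>\<^sub>F n in sequentially. 3 * ln (real n) + 1 \<le> real n \<and> 0 \<le> ln (real n)"
    by (intro eventually_conj; real_asymp)
  then have small: "\<forall>\<^sub>F n in sequentially. 3 * t n < n"
  proof eventually_elim
    case (elim n)
    have "real (t n) \<le> ln (real n)" using elim by (simp add: t_def)
    then have "real (3 * t n) < real n" using elim by simp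
    then show ?case by linarith
  qed
  have "\<forall>\<^sub>F n in sequentially. f n \<in> MM n"
    using small
  proof eventually_elim
    case (elim n)
    then obtain m where "n = Suc m" "3 * t n \<le> m" by (cases n) auto
    then show ?case using nae_parity_in_MM by (simp add: f_def)
  qed
  moreover have "(\<lambda>n. real n - real (pdeg n (f n))) \<in> \<Theta>(\<lambda>n. ln (real n))"
  proof (rule bigthetaI'[of "1 / 2" 1])
    \<comment> \<open>From 2 on, \<open>ln n - 1\<close> is at least half of \<open>ln n\<close>,
      which absorbs the loss from the floor.\<close>
    have "\<forall>\<^sub>F n in sequentially. 2 \<le> ln (real n)" by real_asymp
    with small show "\<forall>\<^sub>F n in sequentially.
        1 / 2 * norm (ln (real n)) \<le> norm (real n - real (pdeg n (f n))) \<and>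
        norm (real n - real (pdeg n (f n))) \<le> 1 * norm (ln (real n))"
    proof eventually_elim
      case (elim n)
      have "pdeg n (f n) = n - t n"
        unfolding f_def by (rule pdeg_nae_parity[OF elim(1)])
      then have "real n - real (pdeg n (f n)) = real (t n)"
        using elim(1) by (simp add: of_nat_diff)
      moreover have "ln (real n) - 1 < real (t n)" "real (t n) \<le> ln (real n)"
        using elim(2) unfolding t_def by linarith+
      ultimately show ?case using elim(2) by simp
    qed
  qed simp_all
  ultimately show ?thesis by blast
qed

end
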